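(* Let $n\ge 1$ be an integer, let $m$ be an integer, and let $a,b,k$ be nonnegative integers. Then $$\operatorname{CT}_x \prod_{l=1}^n\left(1-\frac{x_l}{x_0}\right)^{a+\chi(l\le m)}\left(1-\frac{x_0}{x_l}\right)^{b}\prod_{1\le i\ne j\le n}\left(1-\frac{x_i}{x_j}\right)^{k}=\prod_{l=0}^{n-1}\frac{[a+b+kl+\chi(l\ge n-m)]!\,(k(l+1))!}{[a+kl+\chi(l\ge n-m)]!\,(b+kl)!\,k!}.$$
   Context: $\operatorname{CT}_x$ denotes the constant term (the coefficient of $x_0^0x_1^0\cdots x_n^0$) of a Laurent polynomial in $x_0,\ldots,x_n$. The product over $1\le i\neq j\le n$ is over ordered pairs. $\chi(S)$ equals $1$ if the statement $S$ is true and $0$ otherwise. *)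

theory Defs
  imports Complex_Main "HOL-Library.Poly_Mapping"
begin

text \<open>
  Laurent polynomials over the rationals in the variables \<open>x\<^sub>0, x\<^sub>1, x\<^sub>2, \<dots>\<close>: the group algebra
  of the free abelian group of finitely supported exponent vectors \<open>nat \<Rightarrow>\<^sub>0 int\<close>, with the
  convolution product of \<open>Poly_Mapping\<close>. Laurent polynomials in \<open>x\<^sub>0, \<dots>, x\<^sub>n\<close> are the elements
  in which only these variables occur, and their constant term does not depend on \<open>n\<close>.
\<close>
type_synonym laurent = "(nat \<Rightarrow>\<^sub>0 int) \<Rightarrow>\<^sub>0 rat"

definition lvar :: "nat \<Rightarrow> laurent" where
  "lvar i = Poly_Mapping.single (Poly_Mapping.single i 1) 1"

definition lvar_inv :: "nat \<Rightarrow> laurent" where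
  "lvar_inv i = Poly_Mapping.single (Poly_Mapping.single i (- 1)) 1"

definition CT :: "laurent \<Rightarrow> rat" where
  "CT p = Poly_Mapping.lookup p 0"

lemma lvar_mult_lvar_inv: "lvar i * lvar_inv i = 1"
  by (simp add: lvar_def lvar_inv_def mult_single flip: single_add)

end

theory Submission
  imports Defs "HOL-Combinatorics.Transposition"
begin

text \<open>
  The identity is Aomoto's extension of Morris's constant term identity, and the proof is his
  integration by parts carried out on Laurent polynomials. Write \<open>y\<^sub>l = x\<^sub>l / x\<^sub>0\<close>, let \<open>I\<close> be the index
  set \<open>{1..n}\<close>, and for \<open>S \<subseteq> I\<close> let \<open>M(S)\<close> be the product in question in which exactly the factors
  \<open>1 - y\<^sub>l\<close> with \<open>l \<in> S\<close> carry the exponent \<open>a + 1\<close>. An Euler derivation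
  \<open>x\<^sub>i \<partial>/\<partial>x\<^sub>i\<close> multiplies each monomial by its exponent of \<open>x\<^sub>i\<close>, so every image has constant
  term \<open>0\<close>. For \<open>i \<notin> S\<close>, applying it to \<open>M(S \<union> {i}) = (1 - y\<^sub>i) M(S)\<close> gives
  \<open>0 = CT ((- (a + 1) y\<^sub>i - b) M(S) + (1 - y\<^sub>i) \<Sum>\<^sub>j k (y\<^sub>i + y\<^sub>j) / (y\<^sub>i - y\<^sub>j) M(S))\<close>.
  The interaction with \<open>j\<close> is averaged over the exchange of \<open>x\<^sub>i\<close> and \<open>x\<^sub>j\<close>
  (\<open>CT_pair_interaction\<close>): it vanishes for \<open>j \<in> S\<close> and equals \<open>- k CT (y\<^sub>i M(S))\<close> otherwise.
  Since \<open>y\<^sub>i M(S) = M(S) - M(S \<union> {i})\<close>, this is a two-term recurrence (\<open>aomoto_recurrence\<close>).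

  Enlarging \<open>S\<close> from the empty set to \<open>I\<close> turns \<open>a\<close> into \<open>a + 1\<close>, so everything is reduced to
  \<open>a = 0\<close> and \<open>S\<close> empty. There no monomial involves a negative power of \<open>x\<^sub>0\<close>, and only the
  equal-parameter Dyson product over \<open>I\<close> contributes (\<open>CT_morris_initial\<close>). Its constant term
  \<open>(k |I|)! / k!\<^bsup>|I|\<^esup>\<close> comes out of the same argument: the Dyson product over \<open>I\<close> with
  one more index is the Morris product over \<open>I\<close> with \<open>a = b = k\<close>, the new variable playing the part
  of \<open>x\<^sub>0\<close>. Thus \<open>CT_morris_if_CT_dyson\<close> and \<open>CT_dyson\<close> support each other in an induction on the
  number of variables. For this induction the index set \<open>I\<close> and the distinguished index \<open>z \<notin> I\<close>
  (which is \<open>0\<close> in the theorem) have to be arbitrary.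
\<close>

section \<open>Constant terms, Euler derivations and renaming of variables\<close>

text \<open>
  Additive identities need only be checked on monomials; used twice in a row, this settles
  bilinear ones, such as the product rule and the multiplicativity of a renaming.
\<close>

lemma laurent_induct [case_names monomial add]:
  fixes p :: laurent
  assumes "\<And>e c. P (Poly_Mapping.single e c)"
    and "\<And>p q. P p \<Longrightarrow> P q \<Longrightarrow> P (p + q)"
  shows "P p"
proof (induction p rule: Poly_Mapping.update_induct)
  case const
  show ?case using assms(1)[of 0 0] by simp
next
  case (update f e c)
  have "Poly_Mapping.update e c f = f + Poly_Mapping.single e c"
    using update(1) by (intro poly_mapping_eqI)
      (auto simp: lookup_update lookup_add lookup_single in_keys_iff)
  with update assms show ?case by metis
qed

lemma CT_add: "CT (p + q) = CT p + CT q"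
  by (simp add: CT_def lookup_add)

lemma CT_zero: "CT 0 = 0"
  by (simp add: CT_def)

lemma CT_uminus: "CT (- p) = - CT p"
  by (simp add: CT_def)

lemma CT_diff: "CT (p - q) = CT p - CT q"
  by (simp add: CT_def lookup_minus)

lemma CT_sum: "CT (\<Sum>x\<in>A. f x) = (\<Sum>x\<in>A. CT (f x))"
  by (induction A rule: infinite_finite_induct) (auto simp: CT_add CT_zero)

lemma CT_of_nat_mult: "CT (of_nat c * p) = of_nat c * CT p"
  by (induction c) (simp_all add: CT_zero CT_add algebra_simps)

text \<open>The derivation \<open>x\<^sub>i \<partial>/\<partial>x\<^sub>i\<close>.\<close>

definition euler :: "nat \<Rightarrow> laurent \<Rightarrow> laurent" where
  "euler i p = Poly_Mapping.mapp (\<lambda>e c. of_int (Poly_Mapping.lookup e i) * c) p"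

lemma lookup_euler:
  "Poly_Mapping.lookup (euler i p) e = of_int (Poly_Mapping.lookup e i) * Poly_Mapping.lookup p e"
  by (auto simp: euler_def lookup_mapp when_def in_keys_iff)

lemma CT_euler: "CT (euler i p) = 0"
  by (simp add: CT_def lookup_euler)

lemma euler_add: "euler i (p + q) = euler i p + euler i q"
  by (rule poly_mapping_eqI) (simp add: lookup_euler lookup_add algebra_simps)

lemma euler_diff: "euler i (p - q) = euler i p - euler i q"
  by (rule poly_mapping_eqI) (simp add: lookup_euler lookup_minus algebra_simps)

lemma euler_single:
  "euler i (Poly_Mapping.single e c) = Poly_Mapping.single e (of_int (Poly_Mapping.lookup e i) * c)"
  by (rule poly_mapping_eqI) (auto simp: lookup_euler lookup_single when_def)

lemma euler_one: "euler i 1 = 0"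
  by (rule poly_mapping_eqI) (auto simp: lookup_euler lookup_one when_def)

lemma euler_mult: "euler i (p * q) = euler i p * q + p * euler i q"
proof (induction p rule: laurent_induct)
  case (monomial e c)
  show ?case
  proof (induction q rule: laurent_induct)
    case (monomial e' c')
    show ?case
      by (simp add: euler_single mult_single lookup_add algebra_simps flip: single_add)
  next
    case (add p q)
    then show ?case by (simp add: euler_add algebra_simps)
  qed
next
  case (add p q)
  then show ?case by (simp add: euler_add algebra_simps)
qed

lemma euler_power: "euler i (p ^ k) = of_nat k * p ^ (k - 1) * euler i p"
proof (induction k)
  case (Suc k)
  then show ?case by (cases k) (simp_all add: euler_mult algebra_simps)
qed (simp add: euler_one)

lemma euler_prod:
  assumes "finite A"
  shows "euler i (\<Prod>x\<in>A. f x) = (\<Sum>x\<in>A. euler i (f x) * (\<Prod>y\<in>A - {x}. f y))"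
  using assms
proof (induction A)
  case (insert x A)
  have "(\<Prod>y\<in>insert x A - {z}. f y) = f x * (\<Prod>y\<in>A - {z}. f y)" if "z \<in> A" for z
  proof -
    have "insert x A - {z} = insert x (A - {z})" using insert that by auto
    then show ?thesis using insert by simp
  qed
  then have "(\<Sum>z\<in>A. euler i (f z) * (\<Prod>y\<in>insert x A - {z}. f y))
      = f x * (\<Sum>z\<in>A. euler i (f z) * (\<Prod>y\<in>A - {z}. f y))"
    by (simp add: sum_distrib_left mult_ac)
  moreover have "insert x A - {x} = A" using insert by auto
  ultimately show ?case using insert by (simp add: euler_mult)
qed (simp add: euler_one)

lemma euler_prod_eq_0:
  "(\<And>x. x \<in> A \<Longrightarrow> euler i (f x) = 0) \<Longrightarrow> euler i (\<Prod>x\<in>A. f x) = 0"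
  by (induction A rule: infinite_finite_induct) (auto simp: euler_one euler_mult)

text \<open>
  The exchange of \<open>x\<^sub>i\<close> and \<open>x\<^sub>j\<close>. As a transposition is its own inverse, pulling exponent vectors
  back along it is the same as pushing them forward.
\<close>

definition swap_vars :: "nat \<Rightarrow> nat \<Rightarrow> laurent \<Rightarrow> laurent" where
  "swap_vars i j = Poly_Mapping.map_key (Poly_Mapping.map_key (transpose i j))"

lemma map_key_transpose_involutory:
  "Poly_Mapping.map_key (transpose i j) (Poly_Mapping.map_key (transpose i j) e) = e"
  by (rule poly_mapping_eqI) (simp add: map_key.rep_eq)

lemma inj_map_key_transpose: "inj (Poly_Mapping.map_key (transpose i j))"
  by (metis injI map_key_transpose_involutory)

lemma lookup_swap_vars:
  "Poly_Mapping.lookup (swap_vars i j p) e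
     = Poly_Mapping.lookup p (Poly_Mapping.map_key (transpose i j) e)"
  by (simp add: swap_vars_def map_key.rep_eq inj_map_key_transpose)

lemma CT_swap_vars: "CT (swap_vars i j p) = CT p"
  by (simp add: CT_def lookup_swap_vars)

lemma swap_vars_add: "swap_vars i j (p + q) = swap_vars i j p + swap_vars i j q"
  by (rule poly_mapping_eqI) (simp add: lookup_swap_vars lookup_add)

lemma swap_vars_diff: "swap_vars i j (p - q) = swap_vars i j p - swap_vars i j q"
  by (rule poly_mapping_eqI) (simp add: lookup_swap_vars lookup_minus)

lemma swap_vars_single:
  "swap_vars i j (Poly_Mapping.single e c)
     = Poly_Mapping.single (Poly_Mapping.map_key (transpose i j) e) c"
  unfolding swap_vars_def
  by (metis map_key_transpose_involutory inj_map_key_transpose map_key_single)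

lemma swap_vars_mult: "swap_vars i j (p * q) = swap_vars i j p * swap_vars i j q"
proof (induction p rule: laurent_induct)
  case (monomial e c)
  show ?case
  proof (induction q rule: laurent_induct)
    case (monomial e' c')
    show ?case by (simp add: swap_vars_single mult_single map_key_plus)
  next
    case (add p q)
    then show ?case by (simp add: swap_vars_add algebra_simps)
  qed
next
  case (add p q)
  then show ?case by (simp add: swap_vars_add algebra_simps)
qed

lemma swap_vars_one: "swap_vars i j 1 = 1"
  using swap_vars_single[of i j 0 1] by simp

lemma swap_vars_power: "swap_vars i j (p ^ k) = swap_vars i j p ^ k"
  by (induction k) (simp_all add: swap_vars_one swap_vars_mult)

lemma swap_vars_prod: "swap_vars i j (\<Prod>x\<in>A. f x) = (\<Prod>x\<in>A. swap_vars i j (f x))"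
  by (induction A rule: infinite_finite_induct) (simp_all add: swap_vars_one swap_vars_mult)

lemmas swap_vars_hom = swap_vars_one swap_vars_add swap_vars_diff swap_vars_mult swap_vars_power

definition quot :: "nat \<Rightarrow> nat \<Rightarrow> laurent" where
  "quot i j = lvar i * lvar_inv j"

lemma quot_eq_single:
  "quot i j = Poly_Mapping.single (Poly_Mapping.single i 1 + Poly_Mapping.single j (- 1)) 1"
  by (simp add: quot_def lvar_def lvar_inv_def mult_single)

lemma quot_mult_quot: "quot i j * quot j l = quot i l"
  using lvar_mult_lvar_inv[of j] by (simp add: quot_def algebra_simps)

lemma quot_self: "quot i i = 1"
  by (simp add: quot_def lvar_mult_lvar_inv)

lemma euler_quot: "euler h (quot i j) = (of_bool (h = i) - of_bool (h = j)) * quot i j"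
  by (auto simp: quot_eq_single euler_single lookup_add lookup_minus lookup_single when_def
      of_bool_def single_uminus)

lemma swap_vars_quot: "swap_vars i j (quot l h) = quot (transpose i j l) (transpose i j h)"
proof -
  have "Poly_Mapping.map_key (transpose i j) (Poly_Mapping.single l c)
      = Poly_Mapping.single (transpose i j l) c" for l and c :: int
    by (metis inj_transpose map_key_single transpose_involutory)
  then show ?thesis by (simp add: quot_eq_single swap_vars_single map_key_plus)
qed

section \<open>Aomoto's recurrence\<close>

text \<open>
  The factors of the two orderings of a pair are kept together because their product is
  invariant under exchanging the two variables.
\<close>

definition pair_factor :: "nat \<Rightarrow> nat \<Rightarrow> laurent" where
  "pair_factor i j = (1 - quot i j) * (1 - quot j i)"

definition dyson :: "nat set \<Rightarrow> nat \<Rightarrow> laurent" where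
  "dyson I k = (\<Prod>(i, j) \<in> {(i, j). i \<in> I \<and> j \<in> I \<and> i \<noteq> j}. (1 - quot i j) ^ k)"

definition site :: "nat \<Rightarrow> nat \<Rightarrow> nat \<Rightarrow> nat \<Rightarrow> laurent" where
  "site z a b l = (1 - quot l z) ^ a * (1 - quot z l) ^ b"

definition morris :: "nat \<Rightarrow> nat set \<Rightarrow> nat set \<Rightarrow> nat \<Rightarrow> nat \<Rightarrow> nat \<Rightarrow> laurent" where
  "morris z I S a b k = (\<Prod>l\<in>I. site z (a + of_bool (l \<in> S)) b l) * dyson I k"

text \<open>
  This isolates the dependence on one variable before differentiating, and serves to recognise
  a Dyson product with one more variable as a Morris product.
\<close>

lemma dyson_insert:
  assumes "finite I" "i \<notin> I"
  shows "dyson (insert i I) k = dyson I k * (\<Prod>j\<in>I. pair_factor i j ^ k)"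
proof -
  let ?f = "\<lambda>(i, j). (1 - quot i j) ^ k"
  let ?D = "{(i, j). i \<in> I \<and> j \<in> I \<and> i \<noteq> j}"
  have fin: "finite ?D"
    by (rule finite_subset[of _ "I \<times> I"]) (use assms in auto)
  have "{(h, j). h \<in> insert i I \<and> j \<in> insert i I \<and> h \<noteq> j}
      = ?D \<union> (Pair i ` I \<union> (\<lambda>j. (j, i)) ` I)"
    using assms by auto
  moreover have "prod ?f (?D \<union> (Pair i ` I \<union> (\<lambda>j. (j, i)) ` I))
      = prod ?f ?D * prod ?f (Pair i ` I \<union> (\<lambda>j. (j, i)) ` I)"
    by (rule prod.union_disjoint) (use assms fin in auto)
  moreover have "prod ?f (Pair i ` I \<union> (\<lambda>j. (j, i)) ` I)
      = prod ?f (Pair i ` I) * prod ?f ((\<lambda>j. (j, i)) ` I)"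
    by (rule prod.union_disjoint) (use assms in auto)
  moreover have "prod ?f (Pair i ` I) = (\<Prod>j\<in>I. (1 - quot i j) ^ k)"
    by (subst prod.reindex) (auto simp: inj_on_def)
  moreover have "prod ?f ((\<lambda>j. (j, i)) ` I) = (\<Prod>j\<in>I. (1 - quot j i) ^ k)"
    by (subst prod.reindex) (auto simp: inj_on_def)
  ultimately show ?thesis
    by (simp add: dyson_def pair_factor_def power_mult_distrib prod.distrib)
qed

lemma pair_factor_commute: "pair_factor i j = pair_factor j i"
  by (simp add: pair_factor_def mult.commute)

lemma euler_pair_factor:
  assumes "i \<noteq> j"
  shows "euler i (pair_factor i j) = quot j i - quot i j"
  using assms quot_mult_quot[of i j i]
  by (simp add: pair_factor_def euler_mult euler_diff euler_one euler_quot)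
    (simp add: quot_self algebra_simps)

lemma euler_dyson:
  assumes "i \<notin> J"
  shows "euler i (dyson J k) = 0"
  unfolding dyson_def
  by (rule euler_prod_eq_0) (use assms in \<open>auto simp: euler_power euler_diff euler_one euler_quot\<close>)

lemma euler_site_other:
  assumes "i \<noteq> l" "i \<noteq> z"
  shows "euler i (site z a b l) = 0"
  using assms by (simp add: site_def euler_mult euler_power euler_diff euler_one euler_quot)

text \<open>
  The spare factor \<open>1 - y\<close> (where \<open>y = x\<^sub>i / x\<^sub>z\<close>) clears the denominator of the logarithmic
  derivative \<open>- b / (1 - y)\<close> of \<open>(1 - 1/y)\<^sup>b\<close>. This is why the recurrence differentiates the product in
  which \<open>i\<close> already has the raised exponent.
\<close>

lemma euler_site:
  assumes "i \<noteq> z"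
  shows "euler i (site z (Suc a) b i) = - (of_nat (Suc a) * quot i z + of_nat b) * site z a b i"
proof -
  let ?y = "quot i z" and ?y' = "quot z i"
  have inv: "?y * ?y' = 1"
    by (simp add: quot_mult_quot quot_self)
  have 1: "euler i ((1 - ?y) ^ Suc a) = - of_nat (Suc a) * (1 - ?y) ^ a * ?y"
    using assms by (simp add: euler_power euler_diff euler_one euler_quot del: of_nat_Suc power_Suc)
  have 2: "(1 - ?y) * euler i ((1 - ?y') ^ b) = - of_nat b * (1 - ?y') ^ b"
  proof (cases b)
    case (Suc c)
    have "(1 - ?y) * ?y' = - (1 - ?y')"
      using inv by (simp add: algebra_simps)
    moreover have "euler i ((1 - ?y') ^ b) = of_nat b * (1 - ?y') ^ c * ?y'"
      using assms Suc
      by (simp add: euler_power euler_diff euler_one euler_quot del: of_nat_Suc power_Suc)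
    then have "(1 - ?y) * euler i ((1 - ?y') ^ b) = of_nat b * (1 - ?y') ^ c * ((1 - ?y) * ?y')"
      by (simp only: mult_ac)
    ultimately have "(1 - ?y) * euler i ((1 - ?y') ^ b) = of_nat b * (1 - ?y') ^ c * - (1 - ?y')"
      by (simp only:)
    then show ?thesis
      by (simp only: Suc power_Suc mult_ac mult_minus_left mult_minus_right)
  qed (simp add: euler_one)
  have "euler i (site z (Suc a) b i)
      = euler i ((1 - ?y) ^ Suc a) * (1 - ?y') ^ b
        + (1 - ?y) ^ a * ((1 - ?y) * euler i ((1 - ?y') ^ b))"
    unfolding site_def euler_mult[of i "(1 - ?y) ^ Suc a"] by (simp add: algebra_simps)
  also have "\<dots> = - (of_nat (Suc a) * ?y + of_nat b) * site z a b i"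
    unfolding 1 2 site_def by (simp add: algebra_simps)
  finally show ?thesis .
qed

lemma swap_vars_dyson:
  assumes "i \<notin> K" "j \<notin> K"
  shows "swap_vars i j (dyson K k) = dyson K k"
  unfolding dyson_def swap_vars_prod using assms
  by (intro prod.cong) (auto simp: swap_vars_hom swap_vars_quot transpose_def)

lemma swap_vars_site:
  assumes "i \<noteq> z" "j \<noteq> z"
  shows "swap_vars i j (site z a b l) = site z a b (transpose i j l)"
  using assms by (simp add: site_def swap_vars_hom swap_vars_quot)

lemma swap_vars_pair_factor:
  "swap_vars i j (pair_factor l h) = pair_factor (transpose i j l) (transpose i j h)"
  by (simp add: pair_factor_def swap_vars_hom swap_vars_quot)

lemma swap_vars_of_nat: "swap_vars i j (of_nat c) = of_nat c"
  using swap_vars_single[of i j 0 "of_nat c"] by simp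

text \<open>
  The contribution of the pair \<open>i, j\<close> to the derivative. The derivative of the pair factor is
  antisymmetric in \<open>i\<close> and \<open>j\<close>. If \<open>j \<in> S\<close>, the other factors form the symmetric product containing
  \<open>(1 - y\<^sub>i) (1 - y\<^sub>j)\<close>, so the exchange reverses the sign and the constant term is zero. If
  \<open>j \<notin> S\<close>, only \<open>1 - y\<^sub>i\<close> spoils antisymmetry; averaging with the exchanged term replaces it by
  \<open>(y\<^sub>j - y\<^sub>i) / 2\<close>, and \<open>y\<^sub>j - y\<^sub>i\<close> times the antisymmetric part \<open>x\<^sub>j / x\<^sub>i - x\<^sub>i / x\<^sub>j\<close> restores the
  missing pair factor: the result is \<open>- (y\<^sub>i + y\<^sub>j)\<close> times it. Here \<open>y\<^sub>i\<close> and \<open>y\<^sub>j\<close> contribute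
  equally, again by the exchange.
\<close>

lemma CT_pair_interaction:
  fixes z i j k a b :: nat and K S :: "nat set"
  assumes fin: "finite K" and K: "z \<notin> K" "i \<notin> K" "j \<notin> K"
    and ne: "i \<noteq> j" "i \<noteq> z" "j \<noteq> z" and S: "i \<notin> S"
  defines "H \<equiv> (\<Prod>l\<in>insert j K. site z (a + of_bool (l \<in> S)) b l) * dyson (insert j K) k"
  shows "CT ((1 - quot i z) * (site z a b i * H *
            (euler i (pair_factor i j ^ k) * (\<Prod>l\<in>K. pair_factor i l ^ k))))
       = - of_bool (j \<notin> S) * of_nat k * CT (quot i z * morris z (insert i (insert j K)) S a b k)"
proof -
  let ?s = "swap_vars i j" and ?E = "pair_factor i j"
  let ?y = "quot i z" and ?w = "quot j z"
  \<comment> \<open>\<open>X\<close> collects the factors at the remaining indices and those linking them to \<open>i\<close> or \<open>j\<close>; the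
    exchange of \<open>i\<close> and \<open>j\<close> fixes it. The derivative of the pair factor itself is \<open>r\<close> below.\<close>
  define X where "X = (\<Prod>l\<in>K. site z (a + of_bool (l \<in> S)) b l) * dyson K k
      * (\<Prod>l\<in>K. (pair_factor i l * pair_factor j l) ^ k)"
  define c where "c = a + of_bool (j \<in> S)"
  define U where "U = site z a b i * H *
            (euler i (?E ^ k) * (\<Prod>l\<in>K. pair_factor i l ^ k))"
  let ?N = "morris z (insert i (insert j K)) S a b k"
  have sX: "?s X = X"
  proof -
    have *: "transpose i j l = l" if "l \<in> K" for l
      using that K by (auto simp: transpose_def)
    have "?s X = (\<Prod>l\<in>K. ?s (site z (a + of_bool (l \<in> S)) b l)) * dyson K k
        * (\<Prod>l\<in>K. (?s (pair_factor i l) * ?s (pair_factor j l)) ^ k)"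
      by (simp only: X_def swap_vars_mult swap_vars_prod swap_vars_power swap_vars_dyson[OF K(2,3)])
    also have "(\<Prod>l\<in>K. ?s (site z (a + of_bool (l \<in> S)) b l))
        = (\<Prod>l\<in>K. site z (a + of_bool (l \<in> S)) b l)"
      by (rule prod.cong) (simp_all only: * swap_vars_site[OF ne(2,3)])
    also have "(\<Prod>l\<in>K. (?s (pair_factor i l) * ?s (pair_factor j l)) ^ k)
        = (\<Prod>l\<in>K. (pair_factor i l * pair_factor j l) ^ k)"
    proof (rule prod.cong)
      fix l assume "l \<in> K"
      then have "?s (pair_factor i l) = pair_factor j l" "?s (pair_factor j l) = pair_factor i l"
        by (simp_all add: swap_vars_pair_factor *)
      then show "(?s (pair_factor i l) * ?s (pair_factor j l)) ^ k
          = (pair_factor i l * pair_factor j l) ^ k"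
        by (simp only: mult.commute)
    qed simp
    finally show ?thesis unfolding X_def .
  qed
  have sE: "?s ?E = ?E"
    by (simp add: swap_vars_pair_factor pair_factor_commute)
  have H_eq: "H * (\<Prod>l\<in>K. pair_factor i l ^ k) = site z c b j * X"
    using fin K by (simp add: H_def X_def c_def dyson_insert power_mult_distrib prod.distrib mult_ac)
  define r where "r = quot j i - quot i j"
  have U_eq: "U = site z a b i * site z c b j * X * of_nat k * ?E ^ (k - 1) * r"
    using H_eq ne unfolding U_def r_def
    by (simp add: euler_power euler_pair_factor mult_ac)
  have N_eq: "?N = site z a b i * site z c b j * X * ?E ^ k"
    using fin K ne S
    by (simp add: morris_def X_def c_def dyson_insert power_mult_distrib prod.distrib mult_ac)
  have cancel: "(?w - ?y) * U = - of_nat k * ((?y + ?w) * ?N)"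
  proof -
    have r: "(?w - ?y) * r = - ((?y + ?w) * ?E)"
      using quot_mult_quot[of i j z] quot_mult_quot[of j i z] quot_mult_quot[of i j i]
      by (simp add: r_def pair_factor_def quot_self algebra_simps)
    have e: "of_nat k * (?E ^ (k - 1) * ?E) = of_nat k * ?E ^ k"
      by (cases k) (simp_all add: mult_ac)
    have "(?w - ?y) * U = site z a b i * site z c b j * X * (of_nat k * ?E ^ (k - 1))
        * ((?w - ?y) * r)"
      unfolding U_eq by (simp only: mult_ac)
    also have "\<dots> = - (site z a b i * site z c b j * X * (?y + ?w)) * (of_nat k * (?E ^ (k - 1) * ?E))"
      unfolding r by (simp add: mult_ac)
    also have "\<dots> = - of_nat k * ((?y + ?w) * ?N)"
      unfolding e N_eq by (simp add: mult_ac)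
    finally show ?thesis .
  qed
  have sy: "?s ?y = ?w" "?s ?w = ?y"
    using ne by (simp_all add: swap_vars_quot)
  have sr: "?s r = - r"
    by (simp add: r_def swap_vars_diff swap_vars_quot)
  show ?thesis
  proof (cases "j \<in> S")
    case True
    have "site z (Suc a) b l = (1 - quot l z) * site z a b l" for l
      by (simp add: site_def mult_ac)
    then have eq: "(1 - ?y) * U = (1 - ?y) * site z a b i * ((1 - ?w) * site z a b j) * X
        * of_nat k * ?E ^ (k - 1) * r"
      unfolding U_eq c_def using True by (simp add: mult_ac)
    have "?s ((1 - ?y) * U) = - ((1 - ?y) * U)"
      unfolding eq using ne
      by (simp only: swap_vars_hom sX sE sy sr swap_vars_of_nat swap_vars_site[OF ne(2,3)]
          transpose_apply_first transpose_apply_second) (simp add: mult_ac)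
    then have "CT ((1 - ?y) * U) = 0"
      using CT_swap_vars[of i j "(1 - ?y) * U"] by (simp add: CT_uminus)
    then show ?thesis
      using True by (simp add: U_def)
  next
    case False
    then have c: "c = a" by (simp add: c_def)
    have sU: "?s U = - U"
      unfolding U_eq c using ne
      by (simp only: swap_vars_hom sX sE sr swap_vars_of_nat swap_vars_site[OF ne(2,3)]
          transpose_apply_first transpose_apply_second) (simp add: mult_ac)
    have sN: "?s ?N = ?N"
      unfolding N_eq c using ne
      by (simp only: swap_vars_hom sX sE swap_vars_site[OF ne(2,3)]
          transpose_apply_first transpose_apply_second) (simp add: mult_ac)
    have 1: "CT ((1 - ?y) * U) = CT ((1 - ?w) * (- U))"
      by (subst CT_swap_vars[of i j "(1 - ?y) * U", symmetric]) (simp only: swap_vars_hom sU sy)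
    have 2: "CT (?w * ?N) = CT (?y * ?N)"
      by (subst CT_swap_vars[of i j "?y * ?N", symmetric]) (simp only: swap_vars_mult sN sy)
    have 3: "CT ((1 - ?y) * U) = CT U - CT (?y * U)" "CT ((1 - ?w) * (- U)) = CT (?w * U) - CT U"
      "CT ((?w - ?y) * U) = CT (?w * U) - CT (?y * U)"
      by (simp_all add: left_diff_distrib CT_diff CT_uminus)
    have 4: "CT ((?w - ?y) * U) = - (of_nat k * (CT (?y * ?N) + CT (?w * ?N)))"
      unfolding cancel by (simp only: mult_minus_left CT_uminus CT_of_nat_mult distrib_right CT_add)
    have "CT ((1 - ?y) * U) = - (of_nat k * CT (?y * ?N))"
      using 1 3 4 unfolding 2 distrib_left by linarith
    then show ?thesis
      unfolding U_def using False by simp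
  qed
qed

text \<open>
  The constant term of the derivative of the product for \<open>insert i S\<close> is zero. The difference
  \<open>card I - 1 - card S\<close> counts the indices other than \<open>i\<close> outside \<open>S\<close>, the only ones whose
  interaction with \<open>i\<close> survives.
\<close>

lemma aomoto_recurrence:
  fixes z i a b k :: nat and I S :: "nat set"
  assumes fin: "finite I" and z: "z \<notin> I" and i: "i \<in> I" "i \<notin> S" and S: "S \<subseteq> I"
  defines "d \<equiv> k * (card I - 1 - card S)"
  shows "of_nat (a + 1 + d) * CT (morris z I (insert i S) a b k)
       = of_nat (a + b + 1 + d) * CT (morris z I S a b k)"
proof -
  define J where "J = I - {i}"
  have J: "finite J" "i \<notin> J" "z \<notin> J" "I = insert i J" "i \<noteq> z"
    using fin z i by (auto simp: J_def)
  let ?y = "quot i z"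
  let ?N = "morris z I S a b k" and ?M = "morris z I (insert i S) a b k"
  define H where "H = (\<Prod>l\<in>J. site z (a + of_bool (l \<in> S)) b l) * dyson J k"
  define P where "P = (\<Prod>j\<in>J. pair_factor i j ^ k)"
  define U where "U j = site z a b i * H *
      (euler i (pair_factor i j ^ k) * (\<Prod>l\<in>J - {j}. pair_factor i l ^ k))" for j
  have N: "?N = site z a b i * H * P"
    using J i by (simp add: morris_def H_def P_def dyson_insert mult_ac)
  have "(\<Prod>l\<in>J. site z (a + of_bool (l \<in> insert i S)) b l)
      = (\<Prod>l\<in>J. site z (a + of_bool (l \<in> S)) b l)"
    using J by (intro prod.cong) auto
  then have M: "?M = site z (Suc a) b i * H * P"
    using J by (simp add: morris_def H_def P_def dyson_insert mult_ac)
  have step: "site z (Suc a) b i = (1 - ?y) * site z a b i"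
    by (simp add: site_def mult_ac)
  have M_N: "?M = (1 - ?y) * ?N"
    unfolding M N step by (simp add: mult_ac)
  have H0: "euler i H = 0"
    unfolding H_def euler_mult using J
    by (simp add: euler_dyson) (intro disjI1 euler_prod_eq_0 euler_site_other; auto)
  have "euler i ?M = euler i (site z (Suc a) b i) * (H * P)
      + site z (Suc a) b i * H * euler i P"
    unfolding M by (simp add: euler_mult H0 algebra_simps)
  also have "site z (Suc a) b i * H * euler i P = (\<Sum>j\<in>J. (1 - ?y) * U j)"
    unfolding P_def euler_prod[OF J(1)] step U_def by (simp add: sum_distrib_left mult_ac)
  also have "euler i (site z (Suc a) b i) * (H * P)
      = - (of_nat (Suc a) * (?y * ?N) + of_nat b * ?N)"
    unfolding euler_site[OF J(5)] N by (simp add: algebra_simps)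
  finally have "0 = CT (- (of_nat (Suc a) * (?y * ?N) + of_nat b * ?N) + (\<Sum>j\<in>J. (1 - ?y) * U j))"
    by (metis CT_euler)
  then have "0 = - (of_nat (Suc a) * CT (?y * ?N) + of_nat b * CT ?N)
      + (\<Sum>j\<in>J. CT ((1 - ?y) * U j))"
    by (simp only: CT_add CT_uminus CT_of_nat_mult CT_sum)
  also have "(\<Sum>j\<in>J. CT ((1 - ?y) * U j))
      = (\<Sum>j\<in>J. - of_bool (j \<notin> S) * of_nat k * CT (?y * ?N))"
  proof (rule sum.cong)
    fix j assume j: "j \<in> J"
    define K where "K = J - {j}"
    have K: "J = insert j K" "finite K" "z \<notin> K" "i \<notin> K" "j \<notin> K" "i \<noteq> j" "j \<noteq> z" "J - {j} = K"
      using J j by (auto simp: K_def)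
    show "CT ((1 - ?y) * U j) = - of_bool (j \<notin> S) * of_nat k * CT (?y * ?N)"
      using CT_pair_interaction[of K z i j S a b k] K J(5) i(2)
      by (simp only: U_def H_def J(4) K(1) simp_thms)
  qed simp
  also have "\<dots> = - of_nat d * CT (?y * ?N)"
  proof -
    have "card (J - S) = card I - 1 - card S"
      using J i S by (subst card_Diff_subset) (auto intro: finite_subset)
    moreover have "(\<Sum>j\<in>J. of_bool (j \<notin> S) :: rat) = of_nat (card (J - S))"
      using J(1) by (simp add: sum.If_cases of_bool_def Diff_eq Int_def)
    ultimately show ?thesis
      by (simp add: d_def sum_negf mult_ac flip: sum_distrib_right sum_distrib_left)
  qed
  finally have "of_nat (a + 1 + d) * CT (?y * ?N) + of_nat b * CT ?N = 0"
    by (simp add: algebra_simps)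
  moreover have "CT (?y * ?N) = CT ?N - CT ?M"
    unfolding M_N by (simp add: algebra_simps CT_diff)
  ultimately show ?thesis
    by (simp add: algebra_simps)
qed

section \<open>The initial value\<close>

text \<open>
  The order in the variable \<open>x\<^sub>z\<close> is at least \<open>c\<close>. The filtration is phrased with an inequality so
  that the zero polynomial belongs to every level.
\<close>

definition exponents_ge :: "nat \<Rightarrow> int \<Rightarrow> laurent \<Rightarrow> bool" where
  "exponents_ge z c p \<longleftrightarrow> (\<forall>e \<in> Poly_Mapping.keys p. c \<le> Poly_Mapping.lookup e z)"

lemma exponents_ge_add:
  "exponents_ge z c p \<Longrightarrow> exponents_ge z c q \<Longrightarrow> exponents_ge z c (p + q)"
  using keys_add[of p q] unfolding exponents_ge_def by blast

lemma exponents_ge_diff: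
  "exponents_ge z c p \<Longrightarrow> exponents_ge z c q \<Longrightarrow> exponents_ge z c (p - q)"
  using keys_diff[of p q] unfolding exponents_ge_def by blast

lemma exponents_ge_mult:
  "exponents_ge z c p \<Longrightarrow> exponents_ge z d q \<Longrightarrow> exponents_ge z (c + d) (p * q)"
  using keys_mult[of p q] unfolding exponents_ge_def by (fastforce simp: lookup_add)

lemma exponents_ge_mono: "exponents_ge z c p \<Longrightarrow> d \<le> c \<Longrightarrow> exponents_ge z d p"
  unfolding exponents_ge_def by force

lemma exponents_ge_zero_one: "exponents_ge z c 0" "exponents_ge z 0 1"
  by (auto simp: exponents_ge_def)

lemma exponents_ge_quot:
  "exponents_ge z (of_bool (i = z) - of_bool (j = z)) (quot i j)"
  by (auto simp: exponents_ge_def quot_eq_single lookup_add lookup_minus lookup_single when_def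
      single_uminus split: if_splits)

lemma CT_exponents_ge_1: "exponents_ge z 1 p \<Longrightarrow> CT p = 0"
  by (force simp: exponents_ge_def CT_def in_keys_iff)

text \<open>
  Products of elements congruent to \<open>1\<close> modulo positive powers of \<open>x\<^sub>z\<close> stay so, because
  \<open>p q - 1 = (p - 1) (q - 1) + (p - 1) + (q - 1)\<close>.
\<close>

lemma exponents_ge_1_mult_minus_1:
  assumes "exponents_ge z 1 (p - 1)" "exponents_ge z 1 (q - 1)"
  shows "exponents_ge z 1 (p * q - 1)"
proof -
  have "exponents_ge z (1 + 1) ((p - 1) * (q - 1))"
    using assms by (rule exponents_ge_mult)
  then have "exponents_ge z 1 ((p - 1) * (q - 1) + ((p - 1) + (q - 1)))"
    using assms by (intro exponents_ge_add) (auto elim: exponents_ge_mono)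
  then show ?thesis by (simp add: algebra_simps)
qed

lemma exponents_ge_1_prod_minus_1:
  "(\<And>x. x \<in> A \<Longrightarrow> exponents_ge z 1 (f x - 1)) \<Longrightarrow> exponents_ge z 1 (prod f A - 1)"
  by (induction A rule: infinite_finite_induct)
    (simp_all add: exponents_ge_zero_one exponents_ge_1_mult_minus_1)

lemma exponents_ge_0_prod:
  "(\<And>x. x \<in> A \<Longrightarrow> exponents_ge z 0 (f x)) \<Longrightarrow> exponents_ge z 0 (prod f A)"
  by (induction A rule: infinite_finite_induct)
    (use exponents_ge_mult[of z 0 _ 0] in \<open>auto simp: exponents_ge_zero_one\<close>)

lemma exponents_ge_0_dyson:
  assumes "z \<notin> I"
  shows "exponents_ge z 0 (dyson I k)"
  unfolding dyson_def
proof (rule exponents_ge_0_prod, clarify)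
  fix i j assume "i \<in> I" "j \<in> I"
  then have "i \<noteq> z" "j \<noteq> z" using assms by auto
  then have "exponents_ge z 0 (1 - quot i j)"
    using exponents_ge_quot[of z i j]
    by (intro exponents_ge_diff exponents_ge_zero_one) simp
  then show "exponents_ge z 0 ((1 - quot i j) ^ k)"
    using exponents_ge_0_prod[of "{..<k}" z "\<lambda>_. 1 - quot i j"] by simp
qed

text \<open>
  For \<open>a = 0\<close> and \<open>S\<close> empty the factors involving \<open>x\<^sub>z\<close> multiply to \<open>1\<close> plus terms of positive degree in \<open>x\<^sub>z\<close>,
  and the Dyson product is free of \<open>x\<^sub>z\<close>, so it cannot bring these terms back to degree zero.
\<close>

lemma CT_morris_initial:
  assumes "z \<notin> I"
  shows "CT (morris z I {} 0 b k) = CT (dyson I k)"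
proof -
  let ?Q = "\<Prod>l\<in>I. site z 0 b l"
  have "exponents_ge z 1 (?Q - 1)"
  proof (rule exponents_ge_1_prod_minus_1)
    fix l assume "l \<in> I"
    then have "l \<noteq> z" using assms by auto
    then have "exponents_ge z 1 (1 - quot z l - 1)"
      using exponents_ge_quot[of z z l] exponents_ge_diff[of z 1 0 "quot z l"]
      by (auto simp: exponents_ge_zero_one)
    then show "exponents_ge z 1 (site z 0 b l - 1)"
      using exponents_ge_1_prod_minus_1[of "{..<b}" z "\<lambda>_. 1 - quot z l"] by (simp add: site_def)
  qed
  then have "CT ((?Q - 1) * dyson I k) = 0"
    using exponents_ge_0_dyson[OF assms, of k] exponents_ge_mult[of z 1 _ 0]
    by (auto intro: CT_exponents_ge_1)
  moreover have "morris z I {} 0 b k = (?Q - 1) * dyson I k + dyson I k"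
    by (simp add: morris_def algebra_simps)
  ultimately show ?thesis by (simp add: CT_add)
qed

section \<open>Evaluation\<close>

text \<open>
  The closed form for \<open>n\<close> variables of which \<open>s\<close> have the raised exponent.
\<close>

definition morris_value :: "nat \<Rightarrow> nat \<Rightarrow> nat \<Rightarrow> nat \<Rightarrow> nat \<Rightarrow> rat" where
  "morris_value n s a b k = (\<Prod>l = 0..<n.
      (fact (a + b + k * l + of_bool (n \<le> l + s)) * fact (k * (l + 1)))
      / (fact (a + k * l + of_bool (n \<le> l + s)) * fact (b + k * l) * fact k))"

text \<open>
  The closed form obeys Aomoto's recurrence: passing from \<open>s\<close> to \<open>s + 1\<close> changes only the factor
  with \<open>l = n - 1 - s\<close>, by \<open>(a + b + 1 + k l) / (a + 1 + k l)\<close>.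
\<close>

lemma morris_value_Suc:
  fixes n s a b k :: nat
  assumes "s < n"
  defines "d \<equiv> k * (n - 1 - s)"
  shows "of_nat (a + 1 + d) * morris_value n (Suc s) a b k
       = of_nat (a + b + 1 + d) * morris_value n s a b k"
proof -
  define l where "l = n - 1 - s"
  define g :: "nat \<Rightarrow> nat \<Rightarrow> rat" where "g s l =
      (fact (a + b + k * l + of_bool (n \<le> l + s)) * fact (k * (l + 1)))
      / (fact (a + k * l + of_bool (n \<le> l + s)) * fact (b + k * l) * fact k)" for s l
  have l: "l \<in> {0..<n}" using assms by (auto simp: l_def)
  have split: "morris_value n t a b k = g t l * (\<Prod>h\<in>{0..<n} - {l}. g t h)" for t
    unfolding morris_value_def g_def using l by (subst prod.remove[of _ l]) auto
  have "(\<Prod>h\<in>{0..<n} - {l}. g (Suc s) h) = (\<Prod>h\<in>{0..<n} - {l}. g s h)"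
  proof (rule prod.cong)
    fix h assume "h \<in> {0..<n} - {l}"
    then have "(n \<le> h + Suc s) = (n \<le> h + s)" using assms by (auto simp: l_def)
    then show "g (Suc s) h = g s h" unfolding g_def by (simp only:)
  qed simp
  moreover have "of_nat (a + 1 + d) * g (Suc s) l = of_nat (a + b + 1 + d) * g s l"
  proof -
    have "n \<le> l + Suc s" "\<not> n \<le> l + s" "d = k * l" using assms by (auto simp: l_def)
    then have g: "g (Suc s) l = fact (Suc (a + b + d)) * fact (k * (l + 1))
          / (fact (Suc (a + d)) * fact (b + d) * fact k)"
      "g s l = fact (a + b + d) * fact (k * (l + 1)) / (fact (a + d) * fact (b + d) * fact k)"
      unfolding g_def by simp_all
    show ?thesis
      unfolding g fact_Suc by (simp add: field_simps del: of_nat_add of_nat_Suc)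
  qed
  ultimately show ?thesis unfolding split by (metis mult.assoc)
qed

lemma morris_value_all: "morris_value n n a b k = morris_value n 0 (Suc a) b k"
  unfolding morris_value_def by (rule prod.cong) auto

text \<open>
  Both this product and the next one telescope, to the Dyson constants for \<open>n\<close> and for \<open>n + 1\<close>
  variables respectively.
\<close>

lemma morris_value_initial: "morris_value n 0 0 b k = fact (k * n) / fact k ^ n"
proof -
  have "morris_value n 0 0 b k = (\<Prod>l = 0..<n. fact (k * (l + 1)) / (fact (k * l) * fact k))"
    unfolding morris_value_def by (rule prod.cong) auto
  also have "\<dots> = fact (k * n) / fact k ^ n"
    by (induction n) (simp_all add: field_simps)
  finally show ?thesis .
qed

lemma morris_value_diagonal: "morris_value n 0 k k k = fact (k * Suc n) / fact k ^ Suc n"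
proof -
  have "morris_value n 0 k k k
      = (\<Prod>l = 0..<n. fact (k * (l + 2)) / (fact (k * (l + 1)) * fact k))"
    unfolding morris_value_def by (rule prod.cong) (auto simp: algebra_simps)
  also have "\<dots> = fact (k * Suc n) / fact k ^ Suc n"
    by (induction n) (simp_all add: field_simps)
  finally show ?thesis .
qed

text \<open>
  Induction on \<open>a\<close>, with an inner induction that enlarges \<open>S\<close> by the recurrence: the case \<open>S = I\<close>
  for \<open>a\<close> is the case \<open>S = {}\<close> for \<open>a + 1\<close>. The Dyson constant enters as the case \<open>a = 0\<close>.
\<close>

lemma CT_morris_if_CT_dyson:
  assumes fin: "finite I" and z: "z \<notin> I" and S: "S \<subseteq> I"
    and dyson: "CT (dyson I k) = fact (k * card I) / fact k ^ card I"
  shows "CT (morris z I S a b k) = morris_value (card I) (card S) a b k"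
proof -
  have grow: "CT (morris z I T a b k) = morris_value (card I) (card T) a b k"
    if "CT (morris z I {} a b k) = morris_value (card I) 0 a b k" "T \<subseteq> I" for T a
  proof -
    have "finite T" using that(2) fin by (rule finite_subset)
    then show ?thesis using that(2)
    proof (induction T rule: finite_subset_induct')
      case empty
      show ?case using that(1) by simp
    next
      case (insert i T)
      let ?d = "k * (card I - 1 - card T)"
      have "card T < card I"
        using insert fin by (intro psubset_card_mono) auto
      then have "of_nat (a + 1 + ?d) * CT (morris z I (insert i T) a b k)
          = of_nat (a + 1 + ?d) * morris_value (card I) (Suc (card T)) a b k"
        unfolding morris_value_Suc[OF \<open>card T < card I\<close>]
          aomoto_recurrence[OF fin z \<open>i \<in> I\<close> \<open>i \<notin> T\<close> \<open>T \<subseteq> I\<close>]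
        using insert.IH by simp
      moreover have "of_nat (a + 1 + ?d) \<noteq> (0 :: rat)"
        by (simp del: of_nat_add of_nat_mult of_nat_Suc)
      ultimately show ?case
        using insert by (metis card_insert_disjoint mult_cancel_left)
    qed
  qed
  have "CT (morris z I {} a b k) = morris_value (card I) 0 a b k"
  proof (induction a)
    case 0
    show ?case using dyson CT_morris_initial[OF z] by (simp add: morris_value_initial)
  next
    case (Suc a)
    have "morris z I {} (Suc a) b k = morris z I I a b k"
      unfolding morris_def by simp
    then show ?case
      using grow[OF Suc subset_refl] by (simp add: morris_value_all)
  qed
  then show ?thesis using grow S by blast
qed

text \<open>
  The Dyson product over \<open>insert z I\<close> is the Morris product over \<open>I\<close> with \<open>a = b = k\<close> and
  distinguished variable \<open>x\<^sub>z\<close>, and evaluating the latter needs the Dyson constant over \<open>I\<close> only.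
\<close>

lemma CT_dyson:
  assumes "finite I"
  shows "CT (dyson I k) = fact (k * card I) / fact k ^ card I"
  using assms
proof (induction I)
  case empty
  show ?case by (simp add: dyson_def CT_def)
next
  case (insert z I)
  have "morris z I {} k k k = dyson (insert z I) k"
    using insert
    by (simp add: morris_def site_def dyson_insert pair_factor_def power_mult_distrib mult_ac)
  then show ?case
    using CT_morris_if_CT_dyson[OF insert(1,2) _ insert.IH, of "{}" k k] insert
    by (simp add: morris_value_diagonal)
qed

theorem theorem1p3:
  fixes n :: nat and m :: int and a b k :: nat
  assumes "n \<ge> 1"
  shows "CT ((\<Prod>l = 1..n. (1 - lvar l * lvar_inv 0) ^ (a + of_bool (int l \<le> m))
                          * (1 - lvar 0 * lvar_inv l) ^ b)
             * (\<Prod>(i, j) \<in> {(i, j). i \<in> {1..n} \<and> j \<in> {1..n} \<and> i \<noteq> j}.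
                  (1 - lvar i * lvar_inv j) ^ k))
         = (\<Prod>l = 0..<n.
              (fact (a + b + k * l + of_bool (int l \<ge> int n - m)) * fact (k * (l + 1)))
              / (fact (a + k * l + of_bool (int l \<ge> int n - m)) * fact (b + k * l) * fact k))"
    (is "CT ?F = ?R")
proof -
  \<comment> \<open>For \<open>m \<le> 0\<close> this is empty and for \<open>m > n\<close> it is the whole index set, so its cardinality is
    \<open>m\<close> clipped to the range from \<open>0\<close> to \<open>n\<close>.\<close>
  define S where "S = {1..min n (nat m)}"
  have "int l \<le> m \<longleftrightarrow> l \<in> S" if "l \<in> {1..n}" for l
    using that by (auto simp: S_def)
  then have "?F = morris 0 {1..n} S a b k"
    by (simp add: morris_def site_def dyson_def quot_def)
  moreover have "CT (morris 0 {1..n} S a b k) = morris_value n (card S) a b k"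
    using CT_morris_if_CT_dyson[of "{1..n}" 0 S k a b] CT_dyson[of "{1..n}" k]
    by (auto simp: S_def)
  moreover have "morris_value n (card S) a b k = ?R"
    unfolding morris_value_def
  proof (rule prod.cong)
    fix l assume "l \<in> {0..<n}"
    then have "n \<le> l + card S \<longleftrightarrow> int l \<ge> int n - m"
      using assms by (auto simp: S_def min_def nat_le_iff le_nat_iff)
    then show "(fact (a + b + k * l + of_bool (n \<le> l + card S)) * fact (k * (l + 1)))
        / (fact (a + k * l + of_bool (n \<le> l + card S)) * fact (b + k * l) * fact k)
      = (fact (a + b + k * l + of_bool (int l \<ge> int n - m)) * fact (k * (l + 1)))
        / (fact (a + k * l + of_bool (int l \<ge> int n - m)) * fact (b + k * l) * (fact k :: rat))"
      by (simp only:)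
  qed simp
  ultimately show ?thesis by (simp only:)
qed

end
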